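(* Let $\mathfrak{g}\in\mathbb{H}$ and $\mathfrak{h}\in\mathbb{H}_d$, and let $E$ be an $F_{\mathfrak{h}\mathfrak{g}}$-set. For $0<\delta<1$ put $C(\delta)=\int_\delta^1\frac{\mathfrak{g}(u)}{u^2}\,du$. If $h\in\mathbb{H}$ satisfies $$\sum_{k}\sqrt{\frac{\mathfrak{h}^2(2^{-k})\,C(2^{-k})}{h(2^{-k})}}<\infty,$$ then $\mathcal{H}^h(E)>0$.
   Context: $\mathbb{H}$ is the class of non-decreasing, right continuous functions $h:[0,\infty)\to[0,\infty)$ with $h(0)=0$; $\mathbb{H}_d=\{h\in\mathbb{H}: h(2x)\le C h(x)\text{ for all }x \text{ and some } C>0\}$ (doubling). For $h\in\mathbb{H}$, $F\subseteq\mathbb{R}^n$, $\delta>0$: $\mathcal{H}^h_\delta(F)=\inf\{\sum_i h(\mathrm{diam}(F_i)): F\subseteq\bigcup_i F_i,\ \mathrm{diam}(F_i)<\delta\}$ and $\mathcal{H}^h(F)=\sup_{\delta>0}\mathcal{H}^h_\delta(F)$. $\mathbb{S}$ is the unit circle. Given $\mathfrak{h},\mathfrak{g}\in\mathbb{H}$, a set $E\subseteq\mathbb{R}^2$ is an $F_{\mathfrak{h}\mathfrak{g}}$-set if there is $L\subseteq\mathbb{S}$ with $\mathcal{H}^{\mathfrak{g}}(L)>0$ and a number $\delta_E>0$ such that for each $e\in L$ there is a line segment $\ell_e$ in direction $e$ with $\mathcal{H}^{\mathfrak{h}}_\delta(\ell_e\cap E)>1$ for all $0<\delta<\delta_E$.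 *)

theory Defs
  imports "HOL-Analysis.Analysis"
begin

text \<open>The class H: non-decreasing, right continuous functions on [0,oo) with
  values in [0,oo) and h 0 = 0 (values outside [0,oo) are irrelevant).\<close>
definition gauge_H :: "(real \<Rightarrow> real) \<Rightarrow> bool" where
  "gauge_H h \<longleftrightarrow>
     (\<forall>x y. 0 \<le> x \<longrightarrow> x \<le> y \<longrightarrow> h x \<le> h y) \<and>
     (\<forall>x\<ge>0. continuous (at_right x) h) \<and>
     (\<forall>x\<ge>0. 0 \<le> h x) \<and> h 0 = 0"

definition gauge_Hd :: "(real \<Rightarrow> real) \<Rightarrow> bool" where
  "gauge_Hd h \<longleftrightarrow> gauge_H h \<and> (\<exists>C>0. \<forall>x\<ge>0. h (2 * x) \<le> C * h x)"

text \<open>delta-Hausdorff content with gauge h: infimum over countable covers by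
  sets of diameter < delta (such sets are necessarily bounded).\<close>
definition hausdorff_delta :: "(real \<Rightarrow> real) \<Rightarrow> real \<Rightarrow> 'a::metric_space set \<Rightarrow> ennreal" where
  "hausdorff_delta h \<delta> F =
     (INF C \<in> {C :: nat \<Rightarrow> 'a set. F \<subseteq> (\<Union>i. C i) \<and>
                 (\<forall>i. bounded (C i) \<and> diameter (C i) < \<delta>)}.
        (\<Sum>i. ennreal (h (diameter (C i)))))"

definition hausdorff_h :: "(real \<Rightarrow> real) \<Rightarrow> 'a::metric_space set \<Rightarrow> ennreal" where
  "hausdorff_h h F = (SUP \<delta> \<in> {0<..}. hausdorff_delta h \<delta> F)"

definition segment_in_direction :: "real^2 \<Rightarrow> (real^2) set \<Rightarrow> bool" where
  "segment_in_direction e seg \<longleftrightarrow> (\<exists>a t. t > 0 \<and> seg = closed_segment a (a + t *\<^sub>R e))"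

definition F_set :: "(real \<Rightarrow> real) \<Rightarrow> (real \<Rightarrow> real) \<Rightarrow> (real^2) set \<Rightarrow> bool" where
  "F_set hh gg E \<longleftrightarrow>
     (\<exists>L \<subseteq> sphere (0::real^2) 1. hausdorff_h gg L > 0 \<and>
        (\<exists>\<delta>E>0. \<forall>e\<in>L. \<exists>seg. segment_in_direction e seg \<and>
            (\<forall>\<delta>. 0 < \<delta> \<and> \<delta> < \<delta>E \<longrightarrow> hausdorff_delta hh \<delta> (seg \<inter> E) > 1)))"

definition Cfun :: "(real \<Rightarrow> real) \<Rightarrow> real \<Rightarrow> real" where
  "Cfun gg \<delta> = integral {\<delta>..1} (\<lambda>u. gg u / u^2)"

end

theory Submission
  imports Defs
begin

text \<open>
  Let \<open>B\<^sub>i\<close> be a fine cover of \<open>E\<close>, and for each \<open>n\<close> let \<open>E\<^sub>n\<close> be the union of the \<open>B\<^sub>i\<close> of diameter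
  about \<open>2\<^sup>-\<^sup>n\<close>. By pigeonholing with the weights of the summable series, every direction \<open>e\<close> has a
  scale \<open>n\<close> at which the segment in direction \<open>e\<close> meets many dyadic squares of \<open>E\<^sub>n\<close>; let \<open>L\<^sub>n\<close> be the
  set of these directions. A Frostman measure on \<open>L\<^sub>n\<close>, discretised at scale \<open>2\<^sup>-\<^sup>n\<close>, satisfies an
  \<open>L\<^sup>2\<close> Kakeya estimate (Cordoba's argument): two segments whose directions are at distance \<open>d\<close>
  share at most \<open>O(1/d)\<close> squares, so the double sum of the shared squares is an energy, which is
  controlled by \<open>C(2\<^sup>-\<^sup>n)\<close>. Hence the \<open>g\<close>-content of \<open>L\<^sub>n\<close> is at most a constant times the sum of
  \<open>h(diam B\<^sub>i)\<close> over the sets of scale \<open>n\<close>, and summation over \<open>n\<close> bounds the positive \<open>g\<close>-content of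
  the directions by a constant times the sum of all \<open>h(diam B\<^sub>i)\<close>. Working with contents and
  finitely supported measures avoids any measurability assumption on \<open>E\<close> and on the directions.
\<close>

section \<open>Hausdorff contents\<close>

lemma hausdorff_delta_le:
  assumes "F \<subseteq> (\<Union>i. C i)" "\<And>i::nat. bounded (C i)" "\<And>i. diameter (C i) < \<delta>"
  shows "hausdorff_delta h \<delta> F \<le> (\<Sum>i. ennreal (h (diameter (C i))))"
  unfolding hausdorff_delta_def using assms by (intro INF_lower) auto

lemma hausdorff_delta_mono:
  assumes "F \<subseteq> G"
  shows "hausdorff_delta h \<delta> F \<le> hausdorff_delta h \<delta> G"
  unfolding hausdorff_delta_def using assms by (intro INF_superset_mono) auto

text \<open>Each \<open>A n\<close> gets a cover that is optimal up to
  \<open>e * (1/2)^Suc n\<close>; the pairing function enumerates the sets of all these covers, and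
  the errors add up to \<open>e\<close>.\<close>

lemma hausdorff_delta_UN_nat:
  fixes A :: "nat \<Rightarrow> 'a::metric_space set"
  shows "hausdorff_delta h \<delta> (\<Union>n. A n) \<le> (\<Sum>n. hausdorff_delta h \<delta> (A n))"
proof (cases "(\<Sum>n. hausdorff_delta h \<delta> (A n)) < top")
  case True
  show ?thesis
  proof (rule ennreal_le_epsilon)
    fix e :: real assume "0 < e"
    have fin: "hausdorff_delta h \<delta> (A n) < top" for n
      using sum_le_suminf[of "\<lambda>n. hausdorff_delta h \<delta> (A n)" "{n}"] True by (auto intro: le_less_trans)
    have "\<exists>C. A n \<subseteq> (\<Union>i. C i) \<and> (\<forall>i::nat. bounded (C i) \<and> diameter (C i) < \<delta>) \<and>
       (\<Sum>i. ennreal (h (diameter (C i)))) < hausdorff_delta h \<delta> (A n) + ennreal (e * (1/2)^Suc n)" for n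
    proof -
      have "hausdorff_delta h \<delta> (A n) < hausdorff_delta h \<delta> (A n) + ennreal (e * (1/2)^Suc n)"
        using fin[of n] \<open>0 < e\<close> by (simp add: ennreal_add_left_cancel_less)
      then show ?thesis
        unfolding hausdorff_delta_def INF_less_iff by blast
    qed
    from choice[OF allI[OF this]] obtain C where CC: "\<forall>n. A n \<subseteq> (\<Union>i. C n i) \<and>
        (\<forall>i::nat. bounded (C n i) \<and> diameter (C n i) < \<delta>) \<and>
        (\<Sum>i. ennreal (h (diameter (C n i)))) < hausdorff_delta h \<delta> (A n) + ennreal (e * (1/2)^Suc n)"
      by (rule exE)
    then have C: "\<And>n. A n \<subseteq> (\<Union>i. C n i)"
        "\<And>n i. bounded (C n i) \<and> diameter (C n i) < \<delta>"
        "\<And>n. (\<Sum>i. ennreal (h (diameter (C n i)))) < hausdorff_delta h \<delta> (A n) + ennreal (e * (1/2)^Suc n)"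
      by simp_all
    have cov: "(\<Union>n. A n) \<subseteq> (\<Union>i. case_prod C (prod_decode i))"
    proof
      fix x assume "x \<in> (\<Union>n. A n)"
      then obtain n i where "x \<in> C n i" using C(1) by blast
      then have "x \<in> case_prod C (prod_decode (prod_encode (n, i)))" by simp
      then show "x \<in> (\<Union>i. case_prod C (prod_decode i))" by (rule UN_I[OF UNIV_I])
    qed
    have "hausdorff_delta h \<delta> (\<Union>n. A n) \<le> (\<Sum>i. ennreal (h (diameter (case_prod C (prod_decode i)))))"
      by (rule hausdorff_delta_le[OF cov]) (simp_all add: case_prod_beta C(2))
    also have "\<dots> = (\<Sum>n. \<Sum>i. ennreal (h (diameter (C n i))))"
      by (rule suminf_ennreal_2dimen[where f = "\<lambda>p. ennreal (h (diameter (case_prod C p)))"]) simp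
    also have "\<dots> \<le> (\<Sum>n. hausdorff_delta h \<delta> (A n) + ennreal (e * (1/2)^Suc n))"
      using C(3) by (intro suminf_le) (auto intro: less_imp_le)
    also have "\<dots> = (\<Sum>n. hausdorff_delta h \<delta> (A n)) + (\<Sum>n. ennreal (e * (1/2)^Suc n))"
      by (rule suminf_add[symmetric]) auto
    also have "(\<Sum>n. ennreal (e * (1/2)^Suc n)) = ennreal e"
    proof -
      have "(\<lambda>n. e * (1/2)^Suc n) sums (e * 1)"
        by (intro sums_mult power_half_series)
      then show ?thesis using \<open>0 < e\<close> by (subst suminf_ennreal_eq) auto
    qed
    finally show "hausdorff_delta h \<delta> (\<Union>n. A n) \<le> (\<Sum>n. hausdorff_delta h \<delta> (A n)) + ennreal e" .
  qed
qed (simp add: not_less top_unique)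

lemma hausdorff_delta_empty:
  assumes "h 0 = 0" "0 < \<delta>"
  shows "hausdorff_delta h \<delta> ({} :: 'a::metric_space set) = 0"
proof -
  have "hausdorff_delta h \<delta> ({} :: 'a set) \<le> (\<Sum>i::nat. ennreal (h (diameter ({}::'a set))))"
    using assms by (intro hausdorff_delta_le[where C = "\<lambda>_. {}"]) auto
  then show ?thesis using assms by simp
qed

lemma hausdorff_delta_UN_null:
  assumes "countable I" "\<And>i. i \<in> I \<Longrightarrow> hausdorff_delta h \<delta> (A i) = 0" "h 0 = 0" "0 < \<delta>"
  shows "hausdorff_delta h \<delta> (\<Union>i\<in>I. A i) = 0"
proof (cases "I = {}")
  case False
  have "hausdorff_delta h \<delta> (\<Union>n. A (from_nat_into I n)) \<le> (\<Sum>n. hausdorff_delta h \<delta> (A (from_nat_into I n)))"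
    by (rule hausdorff_delta_UN_nat)
  also have "\<dots> = 0" using assms(2) from_nat_into[OF False] by simp
  finally show ?thesis
    using range_from_nat_into[OF False assms(1)] by (metis image_image le_zero_eq)
qed (use assms hausdorff_delta_empty in auto)

lemma hausdorff_delta_UN_finite:
  assumes "finite I" "h 0 = 0" "0 < \<delta>"
  shows "hausdorff_delta h \<delta> (\<Union>i\<in>I. A i) \<le> (\<Sum>i\<in>I. hausdorff_delta h \<delta> (A i))"
  using assms(1)
proof (induction I)
  case (insert i I)
  define U where "U = (\<lambda>n::nat. if n = 0 then A i else if n = 1 then (\<Union>i\<in>I. A i) else {})"
  have "(\<Union>n. U n) = (\<Union>i\<in>insert i I. A i)"
    by (auto simp: U_def split: if_splits)
  then have "hausdorff_delta h \<delta> (\<Union>i\<in>insert i I. A i) \<le> (\<Sum>n. hausdorff_delta h \<delta> (U n))"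
    using hausdorff_delta_UN_nat[of h \<delta> U] by simp
  also have "\<dots> = (\<Sum>n\<in>{0,1}. hausdorff_delta h \<delta> (U n))"
    by (rule suminf_finite) (auto simp: U_def hausdorff_delta_empty assms)
  also have "\<dots> = hausdorff_delta h \<delta> (A i) + hausdorff_delta h \<delta> (\<Union>i\<in>I. A i)"
    by (simp add: U_def)
  finally show ?case using insert by (auto intro: order_trans add_left_mono)
qed (use assms hausdorff_delta_empty in auto)

text \<open>A single set, padded by empty sets of weight \<open>h 0 = 0\<close>, is a cover. The
  case \<open>d = 0\<close> shows that single points have no content.\<close>

lemma hausdorff_delta_small:
  assumes "gauge_H h" "\<And>x y. x \<in> A \<Longrightarrow> y \<in> A \<Longrightarrow> dist x y \<le> d" "0 \<le> d" "d < \<delta>"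
  shows "hausdorff_delta h \<delta> A \<le> ennreal (h d)"
proof -
  define C where "C = (\<lambda>i::nat. if i = 0 then A else {})"
  have h: "diameter A \<le> d" "h 0 = 0" "h (diameter A) \<le> h d"
  proof -
    show d: "diameter A \<le> d" using assms(2,3) by (auto simp: diameter_def intro!: cSUP_least)
    show "h 0 = 0" using assms(1) by (auto simp: gauge_H_def)
    have "0 \<le> diameter A"
      using assms(2) by (intro diameter_ge_0) (metis bounded_def)
    then show "h (diameter A) \<le> h d" using assms(1) d by (auto simp: gauge_H_def)
  qed
  have "bounded A" using assms(2) unfolding bounded_def by (metis)
  have "hausdorff_delta h \<delta> A \<le> (\<Sum>i. ennreal (h (diameter (C i))))"
    using h assms \<open>bounded A\<close> by (intro hausdorff_delta_le) (auto simp: C_def split: if_splits)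
  also have "\<dots> = (\<Sum>i\<in>{0}. ennreal (h (diameter (C i))))"
    by (rule suminf_finite) (auto simp: C_def h)
  also have "\<dots> \<le> ennreal (h d)" using h by (auto simp: C_def intro: ennreal_leI)
  finally show ?thesis .
qed

section \<open>Dyadic squares and a discrete Frostman lemma\<close>

text \<open>Names the half-open square of side \<open>(1/2)^j\<close> that contains
  \<open>x\<close>. The squares of one generation partition the plane, so the number of squares met
  by a set is the cardinality of its image.\<close>

definition dyadic :: "nat \<Rightarrow> real^2 \<Rightarrow> int \<times> int" where
  "dyadic j x = (\<lfloor>2^j * x$1\<rfloor>, \<lfloor>2^j * x$2\<rfloor>)"

lemma dyadic_coarsen:
  assumes "dyadic j x = dyadic j y" "i \<le> j"
  shows "dyadic i x = dyadic i y"
proof -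
  have *: "\<lfloor>2^i * (t::real)\<rfloor> = \<lfloor>2^j * t\<rfloor> div 2^(j-i)" for t
  proof -
    have "2^i * t = 2^j * t / real_of_int (2^(j-i))"
      using assms(2) by (simp add: field_simps flip: power_add)
    then show ?thesis by (simp add: floor_divide_real_eq_div del: of_int_power)
  qed
  show ?thesis using assms(1) by (simp add: dyadic_def *)
qed

text \<open>Passing through the l1 norm keeps the constant rational: 2 instead of the square root of
  2.\<close>

lemma dist_le_if_dyadic_eq:
  assumes "dyadic j x = dyadic j y"
  shows "dist x y \<le> 2 * (1/2)^j"
proof -
  have 1: "\<bar>s - t\<bar> \<le> (1/2)^j" if "\<lfloor>2^j * s\<rfloor> = \<lfloor>2^j * t\<rfloor>" for s t :: real
  proof -
    have "\<bar>2^j * s - 2^j * t\<bar> \<le> 1" using that by linarith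
    then have "2^j * \<bar>s - t\<bar> \<le> 1" by (simp add: abs_mult flip: right_diff_distrib)
    then show ?thesis by (simp add: field_simps power_divide)
  qed
  have "dist x y \<le> \<bar>x$1 - y$1\<bar> + \<bar>x$2 - y$2\<bar>"
    using norm_le_l1_cart[of "x - y"] by (simp add: dist_norm UNIV_2)
  also have "\<dots> \<le> (1/2)^j + (1/2)^j"
    using assms by (intro add_mono 1) (auto simp: dyadic_def)
  finally show ?thesis by simp
qed

text \<open>Relative to one fixed point of \<open>S\<close>, each of the two integer coordinates can
  move by at most \<open>r\<close>.\<close>

lemma dyadic_image_small:
  assumes "\<And>x y. x \<in> S \<Longrightarrow> y \<in> S \<Longrightarrow> dist x y \<le> real r * (1/2)^j"
  shows "finite (dyadic j ` S) \<and> card (dyadic j ` S) \<le> (2*r+1)^2"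
proof (cases "S = {}")
  case False
  then obtain z where z: "z \<in> S" by blast
  obtain a b where ab: "dyadic j z = (a, b)" by force
  let ?R = "{a - int r..a + int r} \<times> {b - int r..b + int r}"
  have "dyadic j ` S \<subseteq> ?R"
  proof (rule image_subsetI)
    fix x assume "x \<in> S"
    have *: "\<bar>2^j * x$i - 2^j * z$i\<bar> \<le> real r" for i
    proof -
      have "\<bar>x$i - z$i\<bar> \<le> real r * (1/2)^j"
        using assms[OF \<open>x \<in> S\<close> z] dist_vec_nth_le[of x i z] by (simp add: dist_real_def)
      then have "2^j * \<bar>x$i - z$i\<bar> \<le> real r" by (simp add: field_simps power_divide)
      then show ?thesis by (simp add: abs_mult flip: right_diff_distrib)
    qed
    show "dyadic j x \<in> ?R"
      using *[of 1] *[of 2] ab by (auto simp: dyadic_def abs_le_iff) linarith+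
  qed
  moreover have "card ?R = (2*r+1)^2"
    by (simp add: card_cartesian_product power2_eq_square nat_add_distrib nat_mult_distrib)
  ultimately show ?thesis
    by (metis card_mono finite_SigmaI finite_atLeastAtMost_int finite_subset)
qed simp

lemma dyadic_image_bounded:
  assumes "bounded S"
  shows "finite (dyadic j ` S)"
proof -
  obtain d where d: "\<And>x y. x \<in> S \<Longrightarrow> y \<in> S \<Longrightarrow> dist x y \<le> d"
    using assms by (metis bounded_two_points dist_commute)
  obtain r :: nat where "d * 2^j \<le> real r" using real_arch_simple by blast
  then have "d \<le> real r * (1/2)^j" by (simp add: field_simps power_divide)
  then show ?thesis using dyadic_image_small[of S r j] d by (meson order_trans)
qed

text \<open>Also serves as a lower bound for the number of squares: a set of large content has to
  meet many of them.\<close>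

lemma hausdorff_delta_dyadic_cover:
  assumes "gauge_H h" "finite (dyadic j ` A)" "2 * (1/2)^j < \<delta>"
  shows "hausdorff_delta h \<delta> A \<le> ennreal (real (card (dyadic j ` A)) * h (2 * (1/2)^j))"
proof -
  have h: "h 0 = 0" "0 < \<delta>" "0 \<le> h (2 * (1/2)^j)"
    using assms by (auto simp: gauge_H_def intro: le_less_trans[OF _ assms(3)])
  have "hausdorff_delta h \<delta> A \<le> hausdorff_delta h \<delta> (\<Union>q\<in>dyadic j ` A. {x \<in> A. dyadic j x = q})"
    by (rule hausdorff_delta_mono) auto
  also have "\<dots> \<le> (\<Sum>q\<in>dyadic j ` A. hausdorff_delta h \<delta> {x \<in> A. dyadic j x = q})"
    using assms h by (intro hausdorff_delta_UN_finite) auto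
  also have "\<dots> \<le> (\<Sum>q\<in>dyadic j ` A. ennreal (h (2 * (1/2)^j)))"
    using assms by (intro sum_mono hausdorff_delta_small dist_le_if_dyadic_eq) auto
  also have "\<dots> = ennreal (real (card (dyadic j ` A)) * h (2 * (1/2)^j))"
    using h by (simp add: ennreal_mult ennreal_of_nat_eq_real_of_nat)
  finally show ?thesis .
qed

lemma dyadic_children:
  assumes "\<And>x y. x \<in> S \<Longrightarrow> y \<in> S \<Longrightarrow> dyadic j x = dyadic j y"
  shows "finite (dyadic (Suc j) ` S)" "card (dyadic (Suc j) ` S) \<le> 4"
proof -
  have "finite (dyadic (Suc j) ` S) \<and> card (dyadic (Suc j) ` S) \<le> 4"
  proof (cases "S = {}")
    case False
    then obtain z where z: "z \<in> S" by blast
    obtain a b where ab: "dyadic j z = (a, b)" by force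
    let ?R = "{2*a, 2*a+1} \<times> {2*b, 2*b+1}"
    have "dyadic (Suc j) ` S \<subseteq> ?R"
    proof (rule image_subsetI)
      fix x assume "x \<in> S"
      then have "dyadic j x = (a, b)" using assms z ab by metis
      moreover have "\<lfloor>2^Suc j * t\<rfloor> \<in> {2*\<lfloor>2^j * t\<rfloor>, 2*\<lfloor>2^j * t\<rfloor>+1}" for t :: real
      proof -
        have "2^Suc j * t = 2 * (2^j * t)" by simp
        then show ?thesis by simp linarith
      qed
      ultimately show "dyadic (Suc j) x \<in> ?R" unfolding dyadic_def by blast
    qed
    moreover have "card ?R = 4" by (simp add: card_cartesian_product)
    ultimately show ?thesis by (metis card_mono finite.intros finite_SigmaI finite_subset)
  qed simp
  then show "finite (dyadic (Suc j) ` S)" "card (dyadic (Suc j) ` S) \<le> 4" by auto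
qed

section \<open>A Frostman lemma for finitely supported measures\<close>

text \<open>The points are treated one after the other, and each receives as much mass as the constraints
  still allow; a constraint that has become an equality stays one.\<close>
lemma greedy_mass:
  fixes w :: "'i \<Rightarrow> real" and Q :: "'i \<Rightarrow> 'a set"
  assumes "finite X" "finite I" "\<And>i. i \<in> I \<Longrightarrow> 0 \<le> w i" "\<And>x. x \<in> X \<Longrightarrow> \<exists>i\<in>I. x \<in> Q i"
  shows "\<exists>\<mu>. (\<forall>x. 0 \<le> \<mu> x) \<and> (\<forall>i\<in>I. sum \<mu> (X \<inter> Q i) \<le> w i) \<and>
             (\<forall>x\<in>X. \<exists>i\<in>I. x \<in> Q i \<and> sum \<mu> (X \<inter> Q i) = w i)"
  using assms(1,4)
proof (induction X)
  case empty
  then show ?case using assms by (intro exI[of _ "\<lambda>_. 0"]) auto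
next
  case (insert z X)
  have "\<exists>\<mu>. (\<forall>x. 0 \<le> \<mu> x) \<and> (\<forall>i\<in>I. sum \<mu> (X \<inter> Q i) \<le> w i) \<and>
          (\<forall>x\<in>X. \<exists>i\<in>I. x \<in> Q i \<and> sum \<mu> (X \<inter> Q i) = w i)"
    using insert.prems by (intro insert.IH) simp
  then obtain \<mu> where \<mu>: "\<And>x. 0 \<le> \<mu> x" "\<And>i. i \<in> I \<Longrightarrow> sum \<mu> (X \<inter> Q i) \<le> w i"
      "\<And>x. x \<in> X \<Longrightarrow> \<exists>i\<in>I. x \<in> Q i \<and> sum \<mu> (X \<inter> Q i) = w i"
    by blast
  \<comment> \<open>The slack left in the constraints that involve \<open>z\<close>. The least slack
    becomes the mass of \<open>z\<close>: nothing is violated and one constraint becomes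
    tight.\<close>
  define S where "S = (\<lambda>i. w i - sum \<mu> (X \<inter> Q i)) ` {i \<in> I. z \<in> Q i}"
  define m where "m = Min S"
  have S: "finite S" "S \<noteq> {}" using assms(2) insert.prems by (auto simp: S_def)
  have m: "m \<in> S" "\<And>s. s \<in> S \<Longrightarrow> m \<le> s" using S by (auto simp: m_def)
  have m0: "0 \<le> m" using m(1) \<mu>(2) by (auto simp: S_def)
  define \<nu> where "\<nu> = \<mu>(z := m)"
  have eq: "sum \<nu> (insert z X \<inter> Q i) = sum \<mu> (X \<inter> Q i) + (if z \<in> Q i then m else 0)" for i
  proof -
    have "sum \<nu> (X \<inter> Q i) = sum \<mu> (X \<inter> Q i)"
      using insert.hyps by (intro sum.cong) (auto simp: \<nu>_def)
    then show ?thesis using insert.hyps by (auto simp: Int_insert_left \<nu>_def)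
  qed
  have le: "sum \<nu> (insert z X \<inter> Q i) \<le> w i" if "i \<in> I" for i
    using \<mu>(2)[OF that] m(2)[of "w i - sum \<mu> (X \<inter> Q i)"] that by (auto simp: eq S_def)
  have "\<exists>i\<in>I. x \<in> Q i \<and> sum \<nu> (insert z X \<inter> Q i) = w i" if xX: "x \<in> insert z X" for x
  proof (cases "x = z")
    case True
    obtain i where i: "i \<in> I" "z \<in> Q i" "m = w i - sum \<mu> (X \<inter> Q i)"
      using m(1) by (auto simp: S_def)
    then show ?thesis using True eq[of i] by (intro bexI[of _ i]) auto
  next
    case False
    then obtain i where i: "i \<in> I" "x \<in> Q i" "sum \<mu> (X \<inter> Q i) = w i"
      using \<mu>(3)[of x] xX by blast
    with le[OF i(1)] m0 show ?thesis by (intro bexI[of _ i]) (auto simp: eq split: if_splits)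
  qed
  with le show ?case using \<mu>(1) m0 by (intro exI[of _ \<nu>]) (auto simp: \<nu>_def)
qed

text \<open>\<open>X\<close> is a finite subset of \<open>A\<close> that meets the same squares of
  generation \<open>n\<close>, and the greedy masses are constrained by the squares of generations
  \<open>m\<close> to \<open>n\<close>. Every point lies in a saturated square, and the largest
  saturated squares are disjoint and cover \<open>A\<close>; hence the sum of \<open>g\<close> over
  them is the total mass. The factor 4 comes from replacing each square by its children.\<close>

lemma frostman_dyadic:
  assumes g: "gauge_H g" and A: "bounded A" and jn: "m \<le> n" and \<delta>: "(1/2)^m < \<delta>"
  obtains X \<mu> where "finite X" "X \<subseteq> A" "\<And>x. 0 \<le> \<mu> x"
    "\<And>j q. m \<le> j \<Longrightarrow> j \<le> n \<Longrightarrow> sum \<mu> {x \<in> X. dyadic j x = q} \<le> g ((1/2)^j)"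
    "hausdorff_delta g \<delta> A \<le> ennreal (4 * sum \<mu> X)"
proof -
  have g0: "0 \<le> g ((1/2)^j)" "g 0 = 0" for j using g by (auto simp: gauge_H_def)
  have "finite (dyadic n ` A)" by (rule dyadic_image_bounded[OF A])
  then obtain X where X: "X \<subseteq> A" "finite X" "dyadic n ` A = dyadic n ` X"
    by (metis finite_subset_image order_refl)
  define I where "I = (SIGMA j:{m..n}. dyadic j ` X)"
  define Q where "Q = (\<lambda>(j, q). {x. dyadic j x = q})"
  have "finite I" using X(2) by (auto simp: I_def)
  moreover have "\<exists>i\<in>I. x \<in> Q i" if "x \<in> X" for x
    using that jn by (intro bexI[of _ "(n, dyadic n x)"]) (auto simp: I_def Q_def)
  ultimately have "\<exists>\<mu>. (\<forall>x. 0 \<le> \<mu> x) \<and> (\<forall>i\<in>I. sum \<mu> (X \<inter> Q i) \<le> g ((1/2)^fst i)) \<and>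
      (\<forall>x\<in>X. \<exists>i\<in>I. x \<in> Q i \<and> sum \<mu> (X \<inter> Q i) = g ((1/2)^fst i))"
    using X(2) g0 by (intro greedy_mass) simp_all
  then obtain \<mu> where \<mu>: "\<And>x. 0 \<le> \<mu> x"
      "\<And>i. i \<in> I \<Longrightarrow> sum \<mu> (X \<inter> Q i) \<le> g ((1/2)^fst i)"
      "\<And>x. x \<in> X \<Longrightarrow> \<exists>i\<in>I. x \<in> Q i \<and> sum \<mu> (X \<inter> Q i) = g ((1/2)^fst i)"
    by blast
  define mass where "mass j q = sum \<mu> {x \<in> X. dyadic j x = q}" for j q
  have XQ: "X \<inter> Q (j, q) = {x \<in> X. dyadic j x = q}" for j q by (auto simp: Q_def)
  have mass_le: "mass j q \<le> g ((1/2)^j)" if "m \<le> j" "j \<le> n" for j q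
  proof (cases "q \<in> dyadic j ` X")
    case True
    then show ?thesis using \<mu>(2)[of "(j, q)"] that by (auto simp: I_def XQ mass_def)
  next
    case False
    then have "{x \<in> X. dyadic j x = q} = {}" by auto
    then show ?thesis using g0 unfolding mass_def by (simp only: sum.empty)
  qed
  define sat where "sat x j \<longleftrightarrow> m \<le> j \<and> j \<le> n \<and> mass j (dyadic j x) = g ((1/2)^j)" for x j
  have ex_sat: "\<exists>j. sat x j" if "x \<in> X" for x
  proof -
    obtain i where "i \<in> I" "x \<in> Q i" "sum \<mu> (X \<inter> Q i) = g ((1/2)^fst i)"
      using \<mu>(3) \<open>x \<in> X\<close> by blast
    then obtain j q where "(j, q) \<in> I" "x \<in> Q (j, q)" "sum \<mu> (X \<inter> Q (j, q)) = g ((1/2)^j)"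
      by (cases i) simp
    then have "sat x j" unfolding XQ by (auto simp: I_def Q_def sat_def mass_def)
    then show ?thesis ..
  qed
  \<comment> \<open>the largest saturated square around each point; these squares are disjoint by nesting\<close>
  define J where "J x = (LEAST j. sat x j)" for x
  have J: "sat x (J x)" "\<And>j. sat x j \<Longrightarrow> J x \<le> j" if "x \<in> X" for x
    using ex_sat[OF that] by (auto simp: J_def intro: LeastI Least_le)
  define T where "T x = (J x, dyadic (J x) x)" for x
  have T_eq: "T y = T x" if "x \<in> X" "y \<in> X" "dyadic (J x) y = dyadic (J x) x" for x y
  proof -
    have "sat y (J x)" using J(1)[OF that(1)] that(3) by (simp add: sat_def)
    then have le: "J y \<le> J x" using J(2) that by blast
    have "dyadic (J y) y = dyadic (J y) x" using dyadic_coarsen[OF that(3) le] .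
    then have "sat x (J y)" using J(1)[OF that(2)] by (simp add: sat_def)
    then have "J x \<le> J y" using J(2) that by blast
    with le show ?thesis using that(3) by (simp add: T_def)
  qed
  have "hausdorff_delta g \<delta> A \<le> hausdorff_delta g \<delta> (\<Union>p\<in>T ` X. {x \<in> A. dyadic (fst p) x = snd p})"
  proof (rule hausdorff_delta_mono, rule subsetI)
    fix x assume "x \<in> A"
    then obtain y where y: "y \<in> X" "dyadic n x = dyadic n y" using X(3) by (metis imageE imageI)
    then have "dyadic (J y) x = dyadic (J y) y"
      using J(1)[OF y(1)] unfolding sat_def by (blast intro: dyadic_coarsen)
    then show "x \<in> (\<Union>p\<in>T ` X. {x \<in> A. dyadic (fst p) x = snd p})"
      using \<open>x \<in> A\<close> y(1) by (intro UN_I[OF imageI[OF y(1)]]) (simp add: T_def)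
  qed
  also have "\<dots> \<le> (\<Sum>p\<in>T ` X. hausdorff_delta g \<delta> {x \<in> A. dyadic (fst p) x = snd p})"
    using X(2) g0 \<delta> by (intro hausdorff_delta_UN_finite) (auto intro: le_less_trans[OF _ \<delta>])
  also have "\<dots> \<le> (\<Sum>p\<in>T ` X. ennreal (4 * mass (fst p) (snd p)))"
  proof (rule sum_mono)
    fix p assume "p \<in> T ` X"
    then obtain y where y: "y \<in> X" "p = T y" by auto
    define j where "j = J y"
    have s: "m \<le> j" "j \<le> n" "mass j (dyadic j y) = g ((1/2)^j)"
      using J(1)[OF y(1)] by (auto simp: sat_def j_def)
    let ?S = "{x \<in> A. dyadic j x = dyadic j y}"
    \<comment> \<open>a square of side \<open>2\<^sup>-\<^sup>j\<close> has a larger diameter; its four children do not\<close>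
    have c: "finite (dyadic (Suc j) ` ?S)" "card (dyadic (Suc j) ` ?S) \<le> 4"
      using dyadic_children[of ?S j] by auto
    have "(1/2::real)^j \<le> (1/2)^m" using s(1) by (intro power_decreasing) auto
    then have "2 * (1/2)^Suc j < \<delta>" using \<delta> unfolding power_Suc by linarith
    from hausdorff_delta_dyadic_cover[OF g c(1) this]
    have "hausdorff_delta g \<delta> ?S \<le> ennreal (real (card (dyadic (Suc j) ` ?S)) * g ((1/2)^j))" by simp
    also have "\<dots> \<le> ennreal (4 * g ((1/2)^j))"
      using c(2) g0 by (intro ennreal_leI mult_right_mono) auto
    finally show "hausdorff_delta g \<delta> {x \<in> A. dyadic (fst p) x = snd p} \<le> ennreal (4 * mass (fst p) (snd p))"
      using s y by (simp add: T_def j_def)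
  qed
  also have "\<dots> = ennreal (\<Sum>p\<in>T ` X. 4 * mass (fst p) (snd p))"
    using \<mu>(1) by (intro sum_ennreal) (auto simp: mass_def intro: sum_nonneg)
  \<comment> \<open>The points that select the square \<open>p\<close> are exactly the points of
    \<open>X\<close> lying in \<open>p\<close>, so the masses of the selected squares add up to the
    mass of \<open>X\<close>.\<close>
  also have "(\<Sum>p\<in>T ` X. 4 * mass (fst p) (snd p)) = 4 * (\<Sum>p\<in>T ` X. sum \<mu> {x \<in> X. T x = p})"
  proof -
    have "mass (fst p) (snd p) = sum \<mu> {x \<in> X. T x = p}" if "p \<in> T ` X" for p
    proof -
      from that obtain y where y: "y \<in> X" "p = T y" by auto
      have "{x \<in> X. dyadic (fst p) x = snd p} = {x \<in> X. T x = p}"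
        using T_eq[OF y(1)] y(2) by (auto simp: T_def)
      then show ?thesis by (simp add: mass_def)
    qed
    then show ?thesis by (simp add: sum_distrib_left)
  qed
  also have "(\<Sum>p\<in>T ` X. sum \<mu> {x \<in> X. T x = p}) = sum \<mu> X"
    using X(2) by (intro sum.group) auto
  finally show ?thesis using that[of X \<mu>] X \<mu>(1) mass_le by (simp add: mass_def)
qed

section \<open>Incidences of segments with dyadic squares\<close>

text \<open>With \<open>c\<close> the cosine of the angle, the squared norm is at least
  \<open>s\<^sup>2 * (1 - c\<^sup>2)\<close>, and \<open>1 - c\<^sup>2 = \<theta>\<^sup>2 * (1 -
  \<theta>\<^sup>2 / 4)\<close> for the chord \<open>\<theta>\<close>. As
  \<open>\<theta> \<le> 1/2\<close>, the last factor is at least 15/16, hence at least 16/25, a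
  rational square. The bound on the chord keeps antipodal directions out, which are far apart but
  parallel.\<close>

lemma transversal_lines:
  fixes e e' :: "'a::real_inner"
  assumes "norm e = 1" "norm e' = 1" "dist e e' \<le> 1/2"
  shows "\<bar>s\<bar> * dist e e' \<le> 5/4 * norm (s *\<^sub>R e - s' *\<^sub>R e')"
proof -
  define \<theta> where "\<theta> = dist e e'"
  define c where "c = inner e e'"
  have ee: "inner e e = 1" "inner e' e' = 1" using assms by (simp_all add: norm_eq_1)
  have "\<theta>\<^sup>2 = 2 - 2 * c"
    unfolding \<theta>_def c_def dist_norm power2_norm_eq_inner
    using ee by (simp add: inner_diff_left inner_diff_right inner_commute)
  then have c: "c = 1 - \<theta>\<^sup>2 / 2" by linarith
  have \<theta>: "0 \<le> \<theta>\<^sup>2" "\<theta>\<^sup>2 \<le> 1/4"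
    using power_mono[OF assms(3), of 2] by (auto simp: \<theta>_def power2_eq_square)
  have n: "(norm (s *\<^sub>R e - s' *\<^sub>R e'))\<^sup>2 = (s' - s * c)\<^sup>2 + s\<^sup>2 * (1 - c\<^sup>2)"
    unfolding power2_norm_eq_inner using ee
    by (simp add: inner_diff_left inner_diff_right inner_commute c_def[symmetric])
       (simp add: power2_eq_square algebra_simps)
  have "(\<bar>s\<bar> * \<theta>)\<^sup>2 = s\<^sup>2 * \<theta>\<^sup>2" by (simp add: power_mult_distrib)
  also have "\<dots> \<le> s\<^sup>2 * (25/16 * (1 - c\<^sup>2))"
  proof (rule mult_left_mono)
    have "\<theta>\<^sup>2 * (16/25) \<le> \<theta>\<^sup>2 * (1 - \<theta>\<^sup>2 / 4)" using \<theta> by (intro mult_left_mono) auto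
    also have "\<dots> = 1 - c\<^sup>2" unfolding c by (simp add: power2_eq_square algebra_simps)
    finally show "\<theta>\<^sup>2 \<le> 25/16 * (1 - c\<^sup>2)" by simp
  qed simp
  also have "\<dots> = 25/16 * (s\<^sup>2 * (1 - c\<^sup>2))" by simp
  also have "\<dots> \<le> 25/16 * ((s' - s * c)\<^sup>2 + s\<^sup>2 * (1 - c\<^sup>2))"
    by (intro mult_left_mono) auto
  also have "\<dots> = (5/4 * norm (s *\<^sub>R e - s' *\<^sub>R e'))\<^sup>2"
    unfolding power_mult_distrib n by (simp add: power_divide)
  finally show ?thesis unfolding \<theta>_def by (rule power2_le_imp_le) simp
qed

text \<open>The segment is cut into \<open>N + 1\<close> pieces of length \<open>(1/2)^n\<close>,
  each of which meets at most 9 squares.\<close>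

lemma card_dyadic_segment:
  assumes "norm e = 1" "0 \<le> T"
  shows "finite (dyadic n ` (\<lambda>t. a + t *\<^sub>R e) ` {t0..t0+T})"
    "real (card (dyadic n ` (\<lambda>t. a + t *\<^sub>R e) ` {t0..t0+T})) \<le> 9 * (T * 2^n + 1)"
proof -
  define s :: real where "s = (1/2)^n"
  have s: "0 < s" "s * 2^n = 1" by (auto simp: s_def power_divide)
  define N where "N = nat \<lfloor>T * 2^n\<rfloor>"
  define P where "P i = (\<lambda>t. a + t *\<^sub>R e) ` {t0 + real i * s .. t0 + real i * s + s}" for i :: nat
  have P: "finite (dyadic n ` P i) \<and> card (dyadic n ` P i) \<le> (2*1+1)^2" for i
  proof (rule dyadic_image_small)
    fix x y assume "x \<in> P i" "y \<in> P i"
    then obtain t u where "x = a + t *\<^sub>R e" "y = a + u *\<^sub>R e"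
        "t \<in> {t0 + real i * s .. t0 + real i * s + s}" "u \<in> {t0 + real i * s .. t0 + real i * s + s}"
      unfolding P_def by blast
    moreover from this have "\<bar>t - u\<bar> \<le> s" by (auto simp: abs_le_iff)
    ultimately show "dist x y \<le> real 1 * (1/2)^n"
      using assms(1) by (simp add: dist_norm s_def flip: scaleR_left_diff_distrib)
  qed
  have sub: "dyadic n ` (\<lambda>t. a + t *\<^sub>R e) ` {t0..t0+T} \<subseteq> (\<Union>i\<in>{..N}. dyadic n ` P i)"
  proof
    fix q assume "q \<in> dyadic n ` (\<lambda>t. a + t *\<^sub>R e) ` {t0..t0+T}"
    then obtain t where t: "t \<in> {t0..t0+T}" "q = dyadic n (a + t *\<^sub>R e)" by blast
    define i where "i = nat \<lfloor>(t - t0) * 2^n\<rfloor>"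
    have "(t - t0) * 2^n \<le> T * 2^n" using t(1) by (intro mult_right_mono) auto
    then have "i \<le> N" unfolding i_def N_def by (intro nat_mono floor_mono)
    have "0 \<le> (t - t0) * 2^n" using t(1) by simp
    then have i: "real i \<le> (t - t0) * 2^n" "(t - t0) * 2^n \<le> real i + 1"
      unfolding i_def by linarith+
    have eq: "(t - t0) * 2^n * s = t - t0" using s(2) by (simp add: mult.assoc mult.commute)
    have "real i * s \<le> t - t0" using mult_right_mono[OF i(1), of s] s eq by simp
    moreover have "t - t0 \<le> real i * s + s"
      using mult_right_mono[OF i(2), of s] s(1) eq by (simp add: algebra_simps)
    ultimately have "a + t *\<^sub>R e \<in> P i" unfolding P_def by (intro imageI) auto
    with \<open>i \<le> N\<close> t(2) show "q \<in> (\<Union>i\<in>{..N}. dyadic n ` P i)" by blast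
  qed
  have fin: "finite (\<Union>i\<in>{..N}. dyadic n ` P i)" using P by blast
  show "finite (dyadic n ` (\<lambda>t. a + t *\<^sub>R e) ` {t0..t0+T})" using sub fin by (rule finite_subset)
  have "card (dyadic n ` (\<lambda>t. a + t *\<^sub>R e) ` {t0..t0+T}) \<le> card (\<Union>i\<in>{..N}. dyadic n ` P i)"
    using fin sub by (rule card_mono)
  also have "\<dots> \<le> (\<Sum>i\<in>{..N}. card (dyadic n ` P i))" by (rule card_UN_le) simp
  also have "\<dots> \<le> (\<Sum>i\<in>{..N}. 9)" using P by (intro sum_mono) simp
  finally have "card (dyadic n ` (\<lambda>t. a + t *\<^sub>R e) ` {t0..t0+T}) \<le> (N + 1) * 9" by simp
  then have "real (card (dyadic n ` (\<lambda>t. a + t *\<^sub>R e) ` {t0..t0+T})) \<le> real ((N + 1) * 9)"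
    by (simp only: of_nat_le_iff)
  moreover have "0 \<le> T * 2^n" using assms by simp
  then have "real N \<le> T * 2^n" unfolding N_def by linarith
  ultimately show "real (card (dyadic n ` (\<lambda>t. a + t *\<^sub>R e) ` {t0..t0+T})) \<le> 9 * (T * 2^n + 1)"
    by simp
qed

text \<open>If the points with parameters \<open>t\<close> and \<open>u\<close> both share a square
  with the second line, transversality gives \<open>\<bar>t - u\<bar> \<le> T\<close>. The common
  squares are thus met by a segment of length \<open>2 * T\<close>, and counting its squares gives
  at most \<open>90 + 9 * \<theta>\<close> after multiplication by \<open>\<theta>\<close>.\<close>

lemma card_dyadic_two_lines:
  assumes "norm e = 1" "norm e' = 1" "dist e e' \<le> 1/2" "e \<noteq> e'"
    and "S \<subseteq> range (\<lambda>t. a + t *\<^sub>R e)" "S' \<subseteq> range (\<lambda>t. a' + t *\<^sub>R e')"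
  shows "real (card (dyadic n ` S \<inter> dyadic n ` S')) * dist e e' \<le> 99"
proof (cases "dyadic n ` S \<inter> dyadic n ` S' = {}")
  case False
  define \<theta> where "\<theta> = dist e e'"
  have \<theta>: "0 < \<theta>" "\<theta> \<le> 1/2" using assms by (auto simp: \<theta>_def)
  define P where "P = {t. a + t *\<^sub>R e \<in> S \<and> (\<exists>t'. dyadic n (a + t *\<^sub>R e) = dyadic n (a' + t' *\<^sub>R e'))}"
  define T where "T = 5 * (1/2)^n / \<theta>"
  have sub: "dyadic n ` S \<inter> dyadic n ` S' \<subseteq> dyadic n ` (\<lambda>t. a + t *\<^sub>R e) ` P"
  proof
    fix q assume "q \<in> dyadic n ` S \<inter> dyadic n ` S'"
    then obtain x y where xy: "x \<in> S" "y \<in> S'" "q = dyadic n x" "dyadic n x = dyadic n y" by auto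
    then obtain t t' where "x = a + t *\<^sub>R e" "y = a' + t' *\<^sub>R e'" using assms(5,6) by blast
    with xy show "q \<in> dyadic n ` (\<lambda>t. a + t *\<^sub>R e) ` P" unfolding P_def by blast
  qed
  have near: "\<bar>t - u\<bar> \<le> T" if tu: "t \<in> P" "u \<in> P" for t u
  proof -
    obtain t' u' where d: "dyadic n (a + t *\<^sub>R e) = dyadic n (a' + t' *\<^sub>R e')"
       "dyadic n (a + u *\<^sub>R e) = dyadic n (a' + u' *\<^sub>R e')" using tu by (auto simp: P_def)
    let ?x = "(a + t *\<^sub>R e) - (a' + t' *\<^sub>R e')" and ?y = "(a + u *\<^sub>R e) - (a' + u' *\<^sub>R e')"
    have "(t - u) *\<^sub>R e - (t' - u') *\<^sub>R e' = ?x - ?y" by (simp add: algebra_simps)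
    then have "norm ((t - u) *\<^sub>R e - (t' - u') *\<^sub>R e') \<le> norm ?x + norm ?y"
      by (simp only: norm_triangle_ineq4)
    also have "\<dots> \<le> 4 * (1/2)^n"
      using dist_le_if_dyadic_eq[OF d(1)] dist_le_if_dyadic_eq[OF d(2)] by (simp only: dist_norm)
    finally have "\<bar>t - u\<bar> * \<theta> \<le> 5 * (1/2)^n"
      using transversal_lines[OF assms(1-3), of "t - u" "t' - u'"] unfolding \<theta>_def by linarith
    then show ?thesis using \<theta> by (simp add: T_def field_simps)
  qed
  obtain t0 where t0: "t0 \<in> P" using False sub by blast
  have "P \<subseteq> {t0 - T .. (t0 - T) + 2 * T}"
    using near[OF t0] by (fastforce simp: abs_le_iff)
  then have "dyadic n ` S \<inter> dyadic n ` S' \<subseteq> dyadic n ` (\<lambda>t. a + t *\<^sub>R e) ` {t0 - T .. (t0 - T) + 2 * T}"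
    using sub by blast
  moreover have T: "0 \<le> 2 * T" using \<theta> by (simp add: T_def)
  ultimately have "card (dyadic n ` S \<inter> dyadic n ` S')
      \<le> card (dyadic n ` (\<lambda>t. a + t *\<^sub>R e) ` {t0 - T .. (t0 - T) + 2 * T})"
    using card_dyadic_segment(1)[OF assms(1) T] by (intro card_mono)
  then have "real (card (dyadic n ` S \<inter> dyadic n ` S')) \<le> 9 * (2 * T * 2^n + 1)"
    using card_dyadic_segment(2)[OF assms(1) T, of n a "t0 - T"] by linarith
  then have "real (card (dyadic n ` S \<inter> dyadic n ` S')) * \<theta> \<le> 9 * (2 * T * 2^n + 1) * \<theta>"
    using \<theta> by (intro mult_right_mono) auto
  also have "\<dots> = 90 + 9 * \<theta>" using \<theta> by (simp add: T_def field_simps power_divide)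
  finally show ?thesis using \<theta> unfolding \<theta>_def by linarith
qed simp

section \<open>Energies and the integral C\<close>

text \<open>By monotonicity the integrand is at least \<open>g s / (2 * s)\<^sup>2\<close> on
  \<open>{s..2 * s}\<close>, so this interval contributes at least a quarter of the term of scale
  \<open>s\<close>.\<close>

lemma dyadic_sum_le_Cfun:
  assumes g: "gauge_H g"
  shows "(\<Sum>j=1..n. 2^j * g ((1/2)^j)) \<le> 4 * Cfun g ((1/2)^n)"
proof (induction n)
  case 0
  then show ?case by (simp add: Cfun_def)
next
  case (Suc n)
  define s :: real where "s = (1/2)^Suc n"
  have s: "0 < s" "2 * s = (1/2)^n" "2^Suc n * s = 1"
    by (auto simp: s_def power_divide)
  then have s1: "2 * s \<le> 1" by (simp add: power_le_one)
  have mono: "\<And>x y. 0 \<le> x \<Longrightarrow> x \<le> y \<Longrightarrow> g x \<le> g y" and g0: "\<And>x. 0 \<le> x \<Longrightarrow> 0 \<le> g x"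
    using g s by (auto simp: gauge_H_def)
  have int: "(\<lambda>u. g u / u\<^sup>2) integrable_on {s..1}"
  proof -
    \<comment> \<open>Integrability of the product with the monotone \<open>g\<close> is read off
      from the second mean value theorem.\<close>
    have "(\<lambda>u::real. 1 / u\<^sup>2) integrable_on {s..1}"
      using s by (intro integrable_continuous_real continuous_intros) auto
    then obtain c where "((\<lambda>u. g u * (1 / u\<^sup>2)) has_integral
        (g s * integral {s..c} (\<lambda>u. 1 / u\<^sup>2) + g 1 * integral {c..1} (\<lambda>u. 1 / u\<^sup>2))) {s..1}"
      by (rule second_mean_value_theorem_full[of "\<lambda>u. 1 / u\<^sup>2" s 1 g]) (use s s1 mono in auto)
    then have "(\<lambda>u. g u * (1 / u\<^sup>2)) integrable_on {s..1}" by blast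
    then show ?thesis by simp
  qed
  have int1: "(\<lambda>u. g u / u\<^sup>2) integrable_on {s..2 * s}"
    using int s s1 by (rule_tac integrable_subinterval_real) auto
  have "g s / (2 * s)\<^sup>2 * s \<le> integral {s..2 * s} (\<lambda>u. g u / u\<^sup>2)"
  proof -
    have "integral {s..2 * s} (\<lambda>u. g s / (2 * s)\<^sup>2) \<le> integral {s..2 * s} (\<lambda>u. g u / u\<^sup>2)"
    proof (rule integral_le[OF _ int1])
      fix u assume "u \<in> {s..2 * s}"
      then show "g s / (2 * s)\<^sup>2 \<le> g u / u\<^sup>2"
        using s mono g0 by (intro frac_le power_mono) auto
    qed auto
    then show ?thesis using s(1) by (simp add: mult.commute)
  qed
  moreover have "g s / (2 * s)\<^sup>2 * s = 2^Suc n * g s / 4"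
    using s(1,3) by (simp add: field_simps power2_eq_square)
  moreover have "Cfun g s = integral {s..2 * s} (\<lambda>u. g u / u\<^sup>2) + Cfun g ((1/2)^n)"
    unfolding Cfun_def s(2)[symmetric]
    using s s1 int by (intro Henstock_Kurzweil_Integration.integral_combine[symmetric]) auto
  ultimately have "2^Suc n * g s + 4 * Cfun g ((1/2)^n) \<le> 4 * Cfun g s" by linarith
  with Suc show ?case by (simp add: s_def)
qed

text \<open>The kernel \<open>\<kappa>\<close> behaves like the inverse distance to
  \<open>e\<close>, truncated at scale \<open>(1/2)^n\<close>. It is dominated by a sum of
  \<open>K * 2^j\<close> over the dyadic balls around \<open>e\<close>, whose masses are at most
  \<open>25 * g ((1/2)^j)\<close>; the previous lemma sums these up, and 100 is 25 times 4.\<close>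

lemma dyadic_energy:
  assumes g: "gauge_H g" and X: "finite X" "e \<in> X" and \<mu>: "\<And>x. 0 \<le> \<mu> x"
    and mn: "1 \<le> m" "m \<le> n"
    and mass: "\<And>j q. m \<le> j \<Longrightarrow> j \<le> n \<Longrightarrow> sum \<mu> {x \<in> X. dyadic j x = q} \<le> g ((1/2)^j)"
    and diam: "\<And>x. x \<in> X \<Longrightarrow> dist e x \<le> (1/2)^m"
    and \<kappa>: "\<And>x. x \<in> X \<Longrightarrow> \<kappa> x \<le> K * 2^n" "\<And>x. x \<in> X \<Longrightarrow> x \<noteq> e \<Longrightarrow> \<kappa> x * dist e x \<le> K / 2"
    and K: "0 \<le> K"
  shows "(\<Sum>x\<in>X. \<mu> x * \<kappa> x) \<le> 100 * K * Cfun g ((1/2)^n)"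
proof -
  define B where "B j = {x \<in> X. dist e x \<le> (1/2)^j}" for j
  have B: "finite (B j)" "B j \<subseteq> X" for j using X by (auto simp: B_def)
  have g0: "0 \<le> g ((1/2)^j)" for j using g by (auto simp: gauge_H_def)
  have ball: "sum \<mu> (B j) \<le> 25 * g ((1/2)^j)" if j: "m \<le> j" "j \<le> n" for j
  proof -
    \<comment> \<open>A ball of radius \<open>(1/2)^j\<close> has diameter at most twice that, so it
      meets at most 25 squares of generation \<open>j\<close>.\<close>
    have "card (dyadic j ` B j) \<le> (2*2+1)^2"
    proof (rule conjunct2[OF dyadic_image_small])
      fix x y assume "x \<in> B j" "y \<in> B j"
      then show "dist x y \<le> real 2 * (1/2)^j"
        using dist_triangle3[of x y e] by (simp add: B_def)
    qed
    then have c: "card (dyadic j ` B j) \<le> 25" by simp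
    have "sum \<mu> (B j) = (\<Sum>q\<in>dyadic j ` B j. sum \<mu> {x \<in> B j. dyadic j x = q})"
      using B by (intro sum.group[symmetric]) auto
    also have "\<dots> \<le> (\<Sum>q\<in>dyadic j ` B j. g ((1/2)^j))"
      using B j by (intro sum_mono order_trans[OF sum_mono2 mass]) (auto simp: \<mu> X)
    also have "\<dots> = card (dyadic j ` B j) * g ((1/2)^j)" by simp
    also have "\<dots> \<le> 25 * g ((1/2)^j)" using c g0 by (intro mult_right_mono) auto
    finally show ?thesis .
  qed
  have "\<kappa> x \<le> (\<Sum>j=m..n. K * 2^j * indicator (B j) x)" if x: "x \<in> X" for x
  proof -
    \<comment> \<open>The smallest of the balls containing \<open>x\<close>; its term alone already
      dominates \<open>\<kappa> x\<close>. Being outside the next ball bounds the distance below by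
      \<open>(1/2)^Suc j\<close>, which is what the 2 in \<open>K / 2\<close> compensates.\<close>
    define j where "j = Max {j \<in> {m..n}. x \<in> B j}"
    have "j \<in> {j \<in> {m..n}. x \<in> B j}"
      unfolding j_def using mn diam x by (intro Max_in) (auto simp: B_def)
    then have j: "m \<le> j" "j \<le> n" "x \<in> B j" by auto
    have jmax: "i \<le> j" if "m \<le> i" "i \<le> n" "x \<in> B i" for i
      unfolding j_def using that by (intro Max_ge) auto
    have "\<kappa> x \<le> K * 2^j"
    proof (cases "j = n")
      case False
      then have "x \<notin> B (Suc j)" using jmax[of "Suc j"] j by auto
      then have d: "(1/2)^Suc j < dist e x" using x by (auto simp: B_def)
      then have "x \<noteq> e" by (auto simp: not_less)
      show ?thesis
      proof (rule ccontr)
        assume "\<not> \<kappa> x \<le> K * 2^j"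
        then have "K * 2^j < \<kappa> x" by simp
        moreover have "0 < dist e x" using \<open>x \<noteq> e\<close> by simp
        ultimately have "K * 2^j * dist e x < \<kappa> x * dist e x" by simp
        also have "\<dots> \<le> K / 2" using \<kappa>(2) x \<open>x \<noteq> e\<close> by blast
        finally have "K * 2^j * dist e x < K / 2" .
        moreover have "K * 2^j * (1/2)^Suc j \<le> K * 2^j * dist e x"
          using d K by (intro mult_left_mono) auto
        ultimately show False by (simp add: power_divide)
      qed
    qed (use \<kappa>(1) x in simp)
    also have "\<dots> = K * 2^j * indicator (B j) x" using j by simp
    also have "\<dots> \<le> (\<Sum>j=m..n. K * 2^j * indicator (B j) x)"
      using j K by (intro member_le_sum[where f = "\<lambda>j. K * 2^j * indicator (B j) x"]) auto
    finally show ?thesis .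
  qed
  then have "(\<Sum>x\<in>X. \<mu> x * \<kappa> x) \<le> (\<Sum>x\<in>X. \<mu> x * (\<Sum>j=m..n. K * 2^j * indicator (B j) x))"
    using \<mu> by (intro sum_mono mult_left_mono) auto
  also have "\<dots> = (\<Sum>j=m..n. \<Sum>x\<in>X. K * 2^j * (\<mu> x * indicator (B j) x))"
    unfolding sum_distrib_left by (subst sum.swap) (simp add: mult_ac)
  also have "\<dots> = (\<Sum>j=m..n. K * 2^j * sum \<mu> (B j))"
  proof -
    have "{x \<in> X. x \<in> B j} = B j" for j using B by blast
    then show ?thesis using X by (simp add: sum_distrib_left[symmetric] sum_mult_indicator)
  qed
  also have "\<dots> \<le> (\<Sum>j=m..n. K * 2^j * (25 * g ((1/2)^j)))"
    using ball K by (intro sum_mono mult_left_mono) auto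
  also have "\<dots> = 25 * K * (\<Sum>j=m..n. 2^j * g ((1/2)^j))"
    by (simp add: sum_distrib_left mult_ac)
  also have "\<dots> \<le> 25 * K * (\<Sum>j=1..n. 2^j * g ((1/2)^j))"
    using mn K g0 by (intro mult_left_mono sum_mono2) auto
  also have "\<dots> \<le> 25 * K * (4 * Cfun g ((1/2)^n))"
    using dyadic_sum_le_Cfun[OF g] K by (intro mult_left_mono) auto
  finally show ?thesis by simp
qed

section \<open>The content estimate for the directions\<close>

lemma Cfun_nonneg:
  assumes "gauge_H g"
  shows "0 \<le> Cfun g ((1/2)^n)"
proof -
  have "0 \<le> (\<Sum>j=1..n. 2^j * g ((1/2)^j))"
    using assms by (intro sum_nonneg) (auto simp: gauge_H_def)
  then show ?thesis using dyadic_sum_le_Cfun[OF assms, of n] by linarith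
qed

text \<open>Cordoba's argument: let \<open>F q\<close> be the mass of the directions whose set meets
  the square \<open>q\<close>. Double counting gives \<open>\<beta> * V \<le> sum F Q\<close>,
  Cauchy-Schwarz brings in the sum of the squares of \<open>F\<close>, and that sum is an energy of
  the Frostman measure, at most \<open>V\<close> times a constant multiple of \<open>C\<close>.
  Cancelling one factor \<open>V\<close> leaves the claim for \<open>W = 4 * V\<close>.\<close>

lemma content_le_if_many_incidences:
  assumes g: "gauge_H g" and A: "A \<subseteq> sphere 0 1"
    and diam: "\<And>x y. x \<in> A \<Longrightarrow> y \<in> A \<Longrightarrow> dist x y \<le> (1/2)^m"
    and m: "1 \<le> m" "m \<le> n" "(1/2)^m < \<delta>"
    and S: "\<And>e. e \<in> A \<Longrightarrow> S e \<subseteq> (\<lambda>t. a e + t *\<^sub>R e) ` {0..M}" and M: "1 \<le> M"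
    and Q: "finite Q" "\<And>e. e \<in> A \<Longrightarrow> dyadic n ` S e \<subseteq> Q"
    and \<beta>: "0 \<le> \<beta>" "\<And>e. e \<in> A \<Longrightarrow> \<beta> \<le> real (card (dyadic n ` S e))"
  obtains W where "0 \<le> W" "hausdorff_delta g \<delta> A \<le> ennreal W"
    "\<beta>\<^sup>2 * W \<le> 79200 * M * Cfun g ((1/2)^n) * real (card Q)"
proof -
  have "bounded A" using A bounded_subset[OF bounded_sphere] by blast
  from frostman_dyadic[OF g this m(2,3)]
  obtain X \<mu> where X: "finite X" "X \<subseteq> A" and \<mu>: "\<And>x. 0 \<le> \<mu> x"
    and mass: "\<And>j q. m \<le> j \<Longrightarrow> j \<le> n \<Longrightarrow> sum \<mu> {x \<in> X. dyadic j x = q} \<le> g ((1/2)^j)"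
    and V: "hausdorff_delta g \<delta> A \<le> ennreal (4 * sum \<mu> X)" by blast
  define V where "V = sum \<mu> X"
  define I where "I e = dyadic n ` S e" for e
  define C where "C = Cfun g ((1/2)^n)"
  have C0: "0 \<le> C" unfolding C_def by (rule Cfun_nonneg[OF g])
  have V0: "0 \<le> V" using \<mu> by (simp add: V_def sum_nonneg)
  have I: "I e \<subseteq> Q" "finite (I e)" if "e \<in> X" for e
    using Q X that finite_subset unfolding I_def by blast+
  have e1: "norm e = 1" if "e \<in> X" for e using A X that by auto
  have small: "(1/2::real)^m \<le> 1/2" using power_decreasing[of 1 m "1/2::real"] m by simp
  \<comment> \<open>The value \<open>198 * M\<close> of \<open>K\<close> serves both bounds on the
    kernel: one segment meets at most \<open>18 * M * 2^n\<close> squares, and two segments share at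
    most 99 divided by the distance of their directions.\<close>
  have energy: "(\<Sum>x\<in>X. \<mu> x * real (card (I e \<inter> I x))) \<le> 100 * (198 * M) * C" if e: "e \<in> X" for e
    unfolding C_def
  proof (rule dyadic_energy[OF g X(1) e \<mu> m(1,2) mass])
    fix x assume x: "x \<in> X"
    show "dist e x \<le> (1/2)^m" using diam e x X by blast
    have sub: "I e \<inter> I x \<subseteq> dyadic n ` (\<lambda>t. a e + t *\<^sub>R e) ` {0..0+M}"
      using S[of e] e X unfolding I_def by auto
    have "card (I e \<inter> I x) \<le> card (dyadic n ` (\<lambda>t. a e + t *\<^sub>R e) ` {0..0+M})"
      using card_dyadic_segment(1)[OF e1[OF e], of M n "a e" 0] M sub by (intro card_mono) simp_all
    also have "real \<dots> \<le> 9 * (M * 2^n + 1)"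
      using card_dyadic_segment(2)[OF e1[OF e], of M n "a e" 0] M by simp
    also have "1 \<le> M * 2^n" using mult_mono[of 1 M 1 "2^n"] M by simp
    then have "9 * (M * 2^n + 1) \<le> 198 * M * 2^n" by simp
    finally show "real (card (I e \<inter> I x)) \<le> 198 * M * 2^n" by simp
    assume "x \<noteq> e"
    have "dist e x \<le> 1/2" using diam e x X small by (blast intro: order_trans)
    then have "real (card (I e \<inter> I x)) * dist e x \<le> 99"
      unfolding I_def using S[of e] S[of x] e x X \<open>x \<noteq> e\<close>
      by (intro card_dyadic_two_lines[OF e1[OF e] e1[OF x], where a = "a e" and a' = "a x"]) auto
    then show "real (card (I e \<inter> I x)) * dist e x \<le> 198 * M / 2" using M by simp
  qed (use M in auto)
  define F where "F q = (\<Sum>e\<in>X. \<mu> e * indicator (I e) q)" for q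
  have ind: "(\<Sum>q\<in>Q. indicator B q) = real (card B)" if "B \<subseteq> Q" for B
    using that Q(1) by (simp add: indicator_def of_bool_def sum.If_cases Int_absorb1)
  have "\<beta> * V = (\<Sum>e\<in>X. \<mu> e * \<beta>)" by (simp add: V_def sum_distrib_left sum_distrib_right mult_ac)
  also have "\<dots> \<le> (\<Sum>e\<in>X. \<mu> e * real (card (I e)))"
    using \<beta>(2) X \<mu> unfolding I_def by (intro sum_mono mult_left_mono) auto
  also have "\<dots> = (\<Sum>e\<in>X. \<mu> e * (\<Sum>q\<in>Q. indicator (I e) q))" using ind I by simp
  also have "\<dots> = (\<Sum>q\<in>Q. F q)"
    unfolding F_def sum_distrib_left by (rule sum.swap)
  finally have 1: "\<beta> * V \<le> (\<Sum>q\<in>Q. F q)" .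
  have "(\<Sum>q\<in>Q. (F q)\<^sup>2) = (\<Sum>q\<in>Q. \<Sum>e\<in>X. \<Sum>x\<in>X. \<mu> e * \<mu> x * indicator (I e \<inter> I x) q)"
    unfolding F_def power2_eq_square sum_product by (simp add: indicator_inter_arith mult_ac)
  also have "\<dots> = (\<Sum>e\<in>X. \<Sum>x\<in>X. \<Sum>q\<in>Q. \<mu> e * \<mu> x * indicator (I e \<inter> I x) q)"
    by (subst sum.swap) (intro sum.cong refl sum.swap)
  also have "\<dots> = (\<Sum>e\<in>X. \<Sum>x\<in>X. \<mu> e * \<mu> x * real (card (I e \<inter> I x)))"
    using I by (intro sum.cong refl) (simp add: ind le_infI1 flip: sum_distrib_left)
  also have "\<dots> = (\<Sum>e\<in>X. \<mu> e * (\<Sum>x\<in>X. \<mu> x * real (card (I e \<inter> I x))))"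
    by (simp add: sum_distrib_left mult_ac)
  also have "\<dots> \<le> (\<Sum>e\<in>X. \<mu> e * (100 * (198 * M) * C))"
    using energy \<mu> by (intro sum_mono mult_left_mono) auto
  also have "\<dots> = V * (19800 * M * C)" unfolding V_def sum_distrib_right by simp
  finally have 2: "(\<Sum>q\<in>Q. (F q)\<^sup>2) \<le> V * (19800 * M * C)" .
  have "(\<beta> * V)\<^sup>2 \<le> (\<Sum>q\<in>Q. F q)\<^sup>2" using 1 \<beta>(1) V0 by (intro power_mono) auto
  also have "\<dots> \<le> (\<Sum>q\<in>Q. (F q)\<^sup>2) * real (card Q)"
    using Cauchy_Schwarz_ineq_sum[of F "\<lambda>_. 1" Q] by simp
  also have "\<dots> \<le> V * (19800 * M * C) * real (card Q)" using 2 by (intro mult_right_mono) auto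
  finally have 3: "V * (\<beta>\<^sup>2 * V) \<le> V * (19800 * M * C * real (card Q))"
    by (simp add: power2_eq_square mult_ac)
  have "\<beta>\<^sup>2 * V \<le> 19800 * M * C * real (card Q)"
  proof (cases "V = 0")
    case False
    then show ?thesis using 3 V0 by simp
  qed (use C0 M in simp)
  then have "\<beta>\<^sup>2 * (4 * V) \<le> 79200 * M * C * real (card Q)" by linarith
  with V V0 that[of "4 * V"] show ?thesis unfolding V_def C_def by simp
qed

section \<open>Summation over the scales of a cover\<close>

text \<open>The point is that the constant does not depend on the cover \<open>B\<close>. The
  weights \<open>b\<close> drive the pigeonhole over scales and reappear squared in the incidence
  estimate, where the last condition on \<open>b\<close> absorbs them. The constant is 25 times
  79200, a set of the cover meeting at most 25 squares of its scale.\<close>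

lemma directions_content_le_cover:
  fixes B :: "nat \<Rightarrow> (real^2) set" and hh h g :: "real \<Rightarrow> real" and b :: "nat \<Rightarrow> real"
  assumes g: "gauge_H g" and hh: "gauge_H hh" and h: "gauge_H h"
    and D: "0 < D" "\<And>x. 0 \<le> x \<Longrightarrow> hh (2 * x) \<le> D * hh x" and hpos: "\<And>n::nat. 0 < h ((1/2)^n)"
    and A: "A \<subseteq> sphere 0 1"
    and diam: "\<And>x y. x \<in> A \<Longrightarrow> y \<in> A \<Longrightarrow> dist x y \<le> (1/2)^m"
    and m: "1 \<le> m" "(1/2)^m < \<delta>" "m \<le> k" "(1/2)^k < \<delta>'"
    and seg: "\<And>e. e \<in> A \<Longrightarrow> seg e \<subseteq> (\<lambda>t. a e + t *\<^sub>R e) ` {0..M}" and M: "1 \<le> M"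
    and big: "\<And>e. e \<in> A \<Longrightarrow> 1 < hausdorff_delta hh \<delta>' (seg e \<inter> E)"
    and b: "\<And>n. 0 < b n" "summable b"
      "\<And>n. (hh ((1/2)^n))\<^sup>2 * Cfun g ((1/2)^n) \<le> (b n)\<^sup>2 * h ((1/2)^n)"
    and cover: "E \<subseteq> (\<Union>i. B i)" "\<And>i. bounded (B i)" "\<And>i. diameter (B i) < (1/2)^k"
  shows "hausdorff_delta g \<delta> A \<le> ennreal (1980000 * M * D\<^sup>2 * (suminf b)\<^sup>2) * (\<Sum>i. ennreal (h (diameter (B i))))"
proof (cases "(\<Sum>i. ennreal (h (diameter (B i)))) = top")
  case True
  have "0 < suminf b" using b by (intro suminf_pos) auto
  then have "0 < 1980000 * M * D\<^sup>2 * (suminf b)\<^sup>2" (is "0 < ?c") using M D(1) by simp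
  then have "ennreal ?c * top = top" by (subst ennreal_mult_top) auto
  then show ?thesis unfolding True by (simp only: top_greatest)
next
  case False
  define s where "s i = h (diameter (B i))" for i
  define sc :: "nat \<Rightarrow> real" where "sc n = (1/2)^Suc n" for n
  \<comment> \<open>Classes of comparable diameter. Sets of diameter zero are in none of them and
    are treated separately.\<close>
  define J where "J n = {i. sc n < diameter (B i) \<and> diameter (B i) \<le> 2 * sc n}" for n
  define E' where "E' n = (\<Union>i\<in>J n. B i)" for n
  define I where "I n e = dyadic (Suc n) ` (seg e \<inter> E \<inter> E' n)" for n e
  define H where "H n = hh (2 * sc n)" for n
  \<comment> \<open>The index is shifted because class \<open>n\<close> has scale
    \<open>sc n = (1/2)^Suc n\<close>; the weight \<open>b 0\<close> is left to the sets of diameter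
    zero.\<close>
  define \<beta> where "\<beta> n = b (Suc n) / suminf b" for n
  \<comment> \<open>stated as a product because \<open>H n\<close> may vanish\<close>
  define L where "L n = {e \<in> A. \<beta> n \<le> real (card (I n e)) * H n}" for n
  define c where "c = 1980000 * M * D\<^sup>2 * (suminf b)\<^sup>2"
  have sc: "0 < sc n" "2 * sc n = (1/2)^n" for n by (auto simp: sc_def)
  have diam0: "0 \<le> diameter (B i)" for i using cover(2) by (rule diameter_ge_0)
  have s0: "0 \<le> s i" for i using h diam0 by (auto simp: s_def gauge_H_def)
  have bs: "0 < suminf b" using b by (intro suminf_pos) auto
  have \<beta>0: "0 < \<beta> n" for n using b bs by (simp add: \<beta>_def)
  have H0: "0 \<le> H n" for n using hh sc[of n] by (auto simp: H_def gauge_H_def)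
  have c0: "0 \<le> c" using M by (simp add: c_def)
  have zero: "hh 0 = 0" "h 0 = 0" "g 0 = 0" using hh h g by (auto simp: gauge_H_def)
  have \<delta>0: "0 < \<delta>" "0 < \<delta>'" using m by (auto intro: le_less_trans[rotated])
  have summ: "summable s"
    using False s0 unfolding s_def[symmetric] by (intro summable_suminf_not_top) auto
  \<comment> \<open>The terms \<open>s i\<close> tend to zero, while on \<open>J n\<close> they stay
    above the positive number \<open>h (sc n)\<close>.\<close>
  have finJ: "finite (J n)" for n
  proof -
    have "s \<longlonglongrightarrow> 0" using summ by (rule summable_LIMSEQ_zero)
    moreover have "0 < h (sc n)" using hpos[of "Suc n"] by (simp add: sc_def)
    ultimately have "\<forall>\<^sub>F i in sequentially. s i < h (sc n)" by (rule order_tendstoD(2))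
    then obtain N where N: "\<And>i. N \<le> i \<Longrightarrow> s i < h (sc n)" by (auto simp: eventually_sequentially)
    have "h (sc n) \<le> s i" if "i \<in> J n" for i
      using that h sc[of n] by (auto simp: J_def s_def gauge_H_def)
    then have "J n \<subseteq> {..<N}" using N by (force simp: not_le[symmetric])
    then show ?thesis by (rule finite_subset) simp
  qed
  have Jsum: "real (card (J n)) * h (sc n) \<le> sum s (J n)" for n
  proof -
    have "(\<Sum>i\<in>J n. h (sc n)) \<le> sum s (J n)"
      using h sc[of n] by (intro sum_mono) (auto simp: J_def s_def gauge_H_def)
    then show ?thesis by simp
  qed
  have B_card: "finite (dyadic (Suc n) ` B i) \<and> card (dyadic (Suc n) ` B i) \<le> (2*2+1)^2" if "i \<in> J n" for n i
  proof (rule dyadic_image_small)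
    fix x y assume "x \<in> B i" "y \<in> B i"
    then have "dist x y \<le> diameter (B i)" using cover(2) by (intro diameter_bounded_bound) auto
    then show "dist x y \<le> real 2 * (1/2)^Suc n" using that by (simp add: J_def sc_def)
  qed
  have E'_eq: "dyadic (Suc n) ` E' n = (\<Union>i\<in>J n. dyadic (Suc n) ` B i)" for n
    by (auto simp: E'_def)
  have finQ: "finite (dyadic (Suc n) ` E' n)" for n
    unfolding E'_eq using finJ B_card by (intro finite_UN_I) auto
  have cardQ: "card (dyadic (Suc n) ` E' n) \<le> 25 * card (J n)" for n
  proof -
    have "card (dyadic (Suc n) ` E' n) \<le> (\<Sum>i\<in>J n. card (dyadic (Suc n) ` B i))"
      unfolding E'_eq by (rule card_UN_le[OF finJ])
    also have "\<dots> \<le> (\<Sum>i\<in>J n. 25)" using B_card by (intro sum_mono) auto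
    finally show ?thesis by simp
  qed
  have IQ: "I n e \<subseteq> dyadic (Suc n) ` E' n" for n e by (auto simp: I_def)
  have Jempty: "J n = {}" if "n < k" for n
  proof -
    have "(1/2)^k \<le> sc n" unfolding sc_def using that by (intro power_decreasing) auto
    then have "diameter (B i) < sc n" for i using cover(3)[of i] by linarith
    then have "i \<notin> J n" for i using less_asym by (auto simp: J_def)
    then show ?thesis by blast
  qed
  have small: "(1/2::real)^n \<le> (1/2)^k" if "k \<le> n" for n
    using that by (intro power_decreasing) auto

  \<comment> \<open>Pigeonhole: for a direction in no \<open>L n\<close>, the pieces of its segment
    would have contents of at most \<open>b n / suminf b\<close>, which add up to 1, against
    \<open>big\<close>.\<close>
  have "A \<subseteq> (\<Union>n. L n)"
  proof (rule subsetI, rule ccontr)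
    fix e assume e: "e \<in> A" "e \<notin> (\<Union>n. L n)"
    then have less: "real (card (I n e)) * H n < \<beta> n" for n
      unfolding L_def by (auto simp: not_le)
    define Z where "Z = (\<Union>i\<in>{i. diameter (B i) = 0}. seg e \<inter> E \<inter> B i)"
    define U where "U n = (case n of 0 \<Rightarrow> Z | Suc n \<Rightarrow> seg e \<inter> E \<inter> E' n)" for n
    have Z: "hausdorff_delta hh \<delta>' Z = 0"
      unfolding Z_def
    proof (rule hausdorff_delta_UN_null)
      fix i assume i: "i \<in> {i. diameter (B i) = 0}"
      have "hausdorff_delta hh \<delta>' (seg e \<inter> E \<inter> B i) \<le> ennreal (hh 0)"
      proof (rule hausdorff_delta_small[OF hh])
        fix x y assume "x \<in> seg e \<inter> E \<inter> B i" "y \<in> seg e \<inter> E \<inter> B i"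
        then show "dist x y \<le> 0"
          using i diameter_bounded_bound[OF cover(2), of x i y] by simp
      qed (use \<delta>0 in auto)
      then show "hausdorff_delta hh \<delta>' (seg e \<inter> E \<inter> B i) = 0" using zero by simp
    qed (use zero \<delta>0 in auto)
    have Un: "hausdorff_delta hh \<delta>' (seg e \<inter> E \<inter> E' n) \<le> ennreal (\<beta> n)" for n
    proof (cases "n < k")
      case True
      then have "seg e \<inter> E \<inter> E' n = {}" using Jempty by (simp add: E'_def)
      then show ?thesis using zero \<delta>0 by (simp add: hausdorff_delta_empty)
    next
      case False
      then have "2 * (1/2)^Suc n < \<delta>'" using small[of n] m(4) False unfolding power_Suc by linarith
      moreover have "finite (dyadic (Suc n) ` (seg e \<inter> E \<inter> E' n))"
        using finite_subset[OF IQ finQ] unfolding I_def .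
      ultimately have "hausdorff_delta hh \<delta>' (seg e \<inter> E \<inter> E' n) \<le> ennreal (real (card (I n e)) * H n)"
        unfolding I_def H_def sc_def by (intro hausdorff_delta_dyadic_cover[OF hh])
      also have "\<dots> \<le> ennreal (\<beta> n)" using less by (intro ennreal_leI less_imp_le)
      finally show ?thesis .
    qed
    have "seg e \<inter> E \<subseteq> (\<Union>n. U n)"
    proof
      fix x assume x: "x \<in> seg e \<inter> E"
      then obtain i where i: "x \<in> B i" using cover(1) by blast
      show "x \<in> (\<Union>n. U n)"
      proof (cases "diameter (B i) = 0")
        case True
        then have "x \<in> U 0" using x i by (auto simp: U_def Z_def)
        then show ?thesis by blast
      next
        case False
        then have d: "0 < diameter (B i)" using diam0[of i] by simp
        \<comment> \<open>The first scale below the diameter. Minimality gives the upper bound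
          \<open>2 * sc N\<close>; for \<open>N = 0\<close> it follows from the diameters being less
          than 1.\<close>
        define N where "N = (LEAST n. sc n < diameter (B i))"
        obtain n0 where "(1/2)^n0 < diameter (B i)" using real_arch_pow_inv[OF d, of "1/2"] by auto
        then have "sc n0 < diameter (B i)" using sc[of n0] by simp
        then have N: "sc N < diameter (B i)" unfolding N_def by (rule LeastI)
        have "diameter (B i) \<le> 2 * sc N"
        proof (cases N)
          case 0
          have "(1/2::real)^k \<le> 1" by (simp add: power_le_one)
          then show ?thesis using cover(3)[of i] 0 by (simp add: sc_def)
        next
          case (Suc l)
          then have "\<not> sc l < diameter (B i)" unfolding N_def by (intro not_less_Least) simp
          then show ?thesis using Suc by (simp add: sc_def)
        qed
        with N have "i \<in> J N" by (simp add: J_def)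
        then have "x \<in> U (Suc N)" using x i by (auto simp: U_def E'_def)
        then show ?thesis by blast
      qed
    qed
    then have "hausdorff_delta hh \<delta>' (seg e \<inter> E) \<le> hausdorff_delta hh \<delta>' (\<Union>n. U n)"
      by (rule hausdorff_delta_mono)
    also have "\<dots> \<le> (\<Sum>n. hausdorff_delta hh \<delta>' (U n))" by (rule hausdorff_delta_UN_nat)
    also have "\<dots> \<le> (\<Sum>n. ennreal (b n / suminf b))"
    proof (rule suminf_le)
      fix n show "hausdorff_delta hh \<delta>' (U n) \<le> ennreal (b n / suminf b)"
        using Z Un by (cases n) (auto simp: U_def \<beta>_def)
    qed auto
    also have "\<dots> = ennreal 1"
    proof -
      have "(\<lambda>n. b n / suminf b) sums (suminf b / suminf b)"
        using b by (intro sums_divide summable_sums)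
      then show ?thesis using b bs by (subst suminf_ennreal_eq) (auto intro: less_imp_le)
    qed
    finally show False using big[OF e(1)] by (simp add: not_less[symmetric])
  qed

  have bound: "hausdorff_delta g \<delta> (L n) \<le> ennreal (c * sum s (J n))" for n
  proof (cases "L n = {}")
    case True
    then show ?thesis using zero \<delta>0 by (simp add: hausdorff_delta_empty)
  next
    case False
    then obtain e0 where "e0 \<in> L n" by blast
    \<comment> \<open>A single direction in \<open>L n\<close> forces \<open>H n\<close> to be
      positive and \<open>J n\<close> to be nonempty, hence \<open>k \<le> n\<close>, so that
      generation \<open>Suc n\<close> is fine enough.\<close>
    then have "\<beta> n \<le> real (card (I n e0)) * H n" by (simp add: L_def)
    with \<beta>0[of n] have pos: "0 < real (card (I n e0)) * H n" by linarith
    then have "0 < H n" using H0[of n] by (simp add: zero_less_mult_iff)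
    have "J n \<noteq> {}"
    proof
      assume "J n = {}"
      then have "I n e0 = {}" by (simp add: I_def E'_def)
      then show False using pos by simp
    qed
    then have nk: "k \<le> n" using Jempty by (force simp: not_less[symmetric])
    define C where "C = Cfun g (sc n)"
    have C0: "0 \<le> C" using Cfun_nonneg[OF g, of "Suc n"] by (simp add: C_def sc_def)
    have LA: "L n \<subseteq> A" by (auto simp: L_def)
    have mn: "m \<le> Suc n" using nk m(3) by simp
    have Lb: "\<beta> n / H n \<le> real (card (dyadic (Suc n) ` (seg e \<inter> E \<inter> E' n)))" if "e \<in> L n" for e
      using that \<open>0 < H n\<close> by (simp add: L_def I_def field_simps)
    have b2: "0 \<le> \<beta> n / H n" using \<beta>0[of n] \<open>0 < H n\<close> by simp
    have segL: "seg e \<inter> E \<inter> E' n \<subseteq> (\<lambda>t. a e + t *\<^sub>R e) ` {0..M}" if "e \<in> L n" for e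
      using seg[of e] LA that by blast
    have diamL: "dist x y \<le> (1/2)^m" if "x \<in> L n" "y \<in> L n" for x y using diam LA that by blast
    have IQ': "dyadic (Suc n) ` (seg e \<inter> E \<inter> E' n) \<subseteq> dyadic (Suc n) ` E' n" for e by auto
    obtain W where W: "0 \<le> W" "hausdorff_delta g \<delta> (L n) \<le> ennreal W"
      "(\<beta> n / H n)\<^sup>2 * W \<le> 79200 * M * Cfun g ((1/2)^Suc n) * real (card (dyadic (Suc n) ` E' n))"
      by (rule content_le_if_many_incidences[OF g subset_trans[OF LA A] diamL m(1) mn m(2) segL M finQ IQ' b2 Lb])
    \<comment> \<open>Doubling passes from \<open>hh (2 * sc n)\<close>, the cost of a square, to
      \<open>hh (sc n)\<close>, the value in the series.\<close>
    have HD: "(H n)\<^sup>2 \<le> D\<^sup>2 * (hh (sc n))\<^sup>2"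
      using D(2)[of "sc n"] sc[of n] H0[of n]
      unfolding H_def power_mult_distrib[symmetric] by (intro power_mono) auto
    have bn: "0 < (b (Suc n))\<^sup>2" using b(1)[of "Suc n"] by simp
    have "(b (Suc n))\<^sup>2 * W = (suminf b)\<^sup>2 * (H n)\<^sup>2 * ((\<beta> n / H n)\<^sup>2 * W)"
      using bs \<open>0 < H n\<close> by (simp add: \<beta>_def power_divide power_mult_distrib)
    also have "\<dots> \<le> (suminf b)\<^sup>2 * (H n)\<^sup>2 * (79200 * M * C * (25 * real (card (J n))))"
    proof (rule mult_left_mono)
      have "real (card (dyadic (Suc n) ` E' n)) \<le> 25 * real (card (J n))"
        using cardQ[of n] by linarith
      then show "(\<beta> n / H n)\<^sup>2 * W \<le> 79200 * M * C * (25 * real (card (J n)))"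
        using W(3) C0 M unfolding C_def sc_def by (elim order_trans) (intro mult_left_mono, auto)
    qed simp
    also have "\<dots> = (H n)\<^sup>2 * (1980000 * M * (suminf b)\<^sup>2 * C * real (card (J n)))" by simp
    also have "\<dots> \<le> (D\<^sup>2 * (hh (sc n))\<^sup>2) * (1980000 * M * (suminf b)\<^sup>2 * C * real (card (J n)))"
      using HD C0 M by (intro mult_right_mono) auto
    also have "\<dots> = c * real (card (J n)) * ((hh (sc n))\<^sup>2 * C)" by (simp add: c_def)
    also have "\<dots> \<le> c * real (card (J n)) * ((b (Suc n))\<^sup>2 * h (sc n))"
      using b(3)[of "Suc n"] c0 by (intro mult_left_mono) (auto simp: C_def sc_def)
    also have "\<dots> = (b (Suc n))\<^sup>2 * (c * (real (card (J n)) * h (sc n)))" by simp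
    also have "\<dots> \<le> (b (Suc n))\<^sup>2 * (c * sum s (J n))"
      using Jsum c0 by (intro mult_left_mono) auto
    finally have "W \<le> c * sum s (J n)" using bn by simp
    then show ?thesis using W(2) by (auto intro: order_trans ennreal_leI)
  qed

  have "hausdorff_delta g \<delta> A \<le> hausdorff_delta g \<delta> (\<Union>n. L n)"
    by (rule hausdorff_delta_mono) fact
  also have "\<dots> \<le> (\<Sum>n. hausdorff_delta g \<delta> (L n))" by (rule hausdorff_delta_UN_nat)
  also have "\<dots> \<le> (\<Sum>n. ennreal (c * sum s (J n)))" using bound by (intro suminf_le) auto
  also have "\<dots> \<le> ennreal c * (\<Sum>i. ennreal (s i))"
  proof (rule suminf_le_const)
    fix N
    have disj: "J n \<inter> J n' = {}" if "n < n'" for n n'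
    proof -
      have "2 * sc n' \<le> sc n" using that power_decreasing[of "Suc n" n' "1/2::real"] unfolding sc(2) sc_def[of n] by simp
      then show ?thesis by (force simp: J_def)
    qed
    have "(\<Sum>n<N. ennreal (c * sum s (J n))) = ennreal (c * (\<Sum>n<N. sum s (J n)))"
      using c0 s0 by (subst sum_ennreal) (auto simp: sum_distrib_left intro!: mult_nonneg_nonneg sum_nonneg)
    also have "(\<Sum>n<N. sum s (J n)) = sum s (\<Union>n<N. J n)"
      using finJ disj by (intro sum.UNION_disjoint[symmetric]) (auto, metis disjoint_iff linorder_neqE_nat)
    also have "ennreal (c * sum s (\<Union>n<N. J n)) \<le> ennreal (c * suminf s)"
      using finJ s0 summ c0 by (intro ennreal_leI mult_left_mono sum_le_suminf) auto
    also have "\<dots> = ennreal c * (\<Sum>i. ennreal (s i))"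
      using s0 summ c0 by (simp add: suminf_ennreal2 ennreal_mult suminf_nonneg)
    finally show "(\<Sum>n<N. ennreal (c * sum s (J n))) \<le> ennreal c * (\<Sum>i. ennreal (s i))" .
  qed auto
  finally show ?thesis by (simp add: s_def c_def)
qed

section \<open>Uniform pieces of the directions and conclusion\<close>

theorem theorem3p1:
  fixes gg hh h :: "real \<Rightarrow> real" and E :: "(real^2) set"
  assumes "gauge_H gg" and "gauge_Hd hh" and "F_set hh gg E"
    and "gauge_H h"
    and "\<forall>k::nat. h ((1/2)^k) > 0"
    and "summable (\<lambda>k::nat. sqrt ((hh ((1/2)^k))^2 * Cfun gg ((1/2)^k) / h ((1/2)^k)))"
  shows "hausdorff_h h E > 0"
proof -
  from assms(2) obtain D where hh: "gauge_H hh" and D: "0 < D" "\<And>x. 0 \<le> x \<Longrightarrow> hh (2 * x) \<le> D * hh x"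
    unfolding gauge_Hd_def by blast
  from assms(3) obtain L \<delta>E where L: "L \<subseteq> sphere 0 1" "hausdorff_h gg L > 0" "0 < \<delta>E"
    and segs: "\<forall>e\<in>L. \<exists>seg. segment_in_direction e seg \<and>
            (\<forall>\<delta>. 0 < \<delta> \<and> \<delta> < \<delta>E \<longrightarrow> hausdorff_delta hh \<delta> (seg \<inter> E) > 1)"
    unfolding F_set_def by blast
  define \<delta>' where "\<delta>' = \<delta>E / 2"
  have \<delta>': "0 < \<delta>'" "\<delta>' < \<delta>E" using L(3) by (auto simp: \<delta>'_def)
  have "\<forall>e\<in>L. \<exists>p. 0 < snd p \<and> hausdorff_delta hh \<delta>' (closed_segment (fst p) (fst p + snd p *\<^sub>R e) \<inter> E) > 1"
  proof
    fix e assume "e \<in> L"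
    then obtain s where s: "segment_in_direction e s" "hausdorff_delta hh \<delta>' (s \<inter> E) > 1"
      using segs \<delta>' by blast
    then obtain a t where "0 < t" "s = closed_segment a (a + t *\<^sub>R e)"
      unfolding segment_in_direction_def by blast
    with s show "\<exists>p. 0 < snd p \<and> hausdorff_delta hh \<delta>' (closed_segment (fst p) (fst p + snd p *\<^sub>R e) \<inter> E) > 1"
      by (intro exI[of _ "(a, t)"]) simp
  qed
  from bchoice[OF this] obtain p where p: "\<And>e. e \<in> L \<Longrightarrow> 0 < snd (p e)"
    "\<And>e. e \<in> L \<Longrightarrow> hausdorff_delta hh \<delta>' (closed_segment (fst (p e)) (fst (p e) + snd (p e) *\<^sub>R e) \<inter> E) > 1"
    by blast
  define a where "a e = fst (p e)" for e
  define t where "t e = snd (p e)" for e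
  define seg where "seg e = closed_segment (a e) (a e + t e *\<^sub>R e)" for e
  have t: "0 < t e" and big: "1 < hausdorff_delta hh \<delta>' (seg e \<inter> E)" if "e \<in> L" for e
    using p that by (auto simp: a_def t_def seg_def)
  obtain \<delta> where \<delta>: "0 < \<delta>" "0 < hausdorff_delta gg \<delta> L"
    using L(2) unfolding hausdorff_h_def less_SUP_iff by auto
  obtain m where m: "1 \<le> m" "(1/2)^m < \<delta>"
  proof -
    obtain l where "(1/2)^l < \<delta>" using real_arch_pow_inv[OF \<delta>(1), of "1/2"] by auto
    moreover have "(1/2::real)^Suc l \<le> (1/2)^l" by (intro power_decreasing) auto
    ultimately show ?thesis using that[of "Suc l"] by linarith
  qed
  \<comment> \<open>Countably many pieces, with bounded segment length and directions in one square
    of generation \<open>Suc m\<close>, hence of diameter at most \<open>(1/2)^m\<close>. By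
    countable subadditivity one of them keeps positive content.\<close>
  define P where "P i = {e \<in> L. t e \<le> real (fst i) \<and> dyadic (Suc m) e = snd i}" for i
  have "L = (\<Union>i. P i)"
  proof
    show "L \<subseteq> (\<Union>i. P i)"
    proof
      fix e assume "e \<in> L"
      then have "e \<in> P (nat \<lceil>t e\<rceil>, dyadic (Suc m) e)"
        by (simp add: P_def real_nat_ceiling_ge)
      then show "e \<in> (\<Union>i. P i)" by blast
    qed
  qed (auto simp: P_def)
  moreover have "gg 0 = 0" using assms(1) by (auto simp: gauge_H_def)
  ultimately obtain i where i: "hausdorff_delta gg \<delta> (P i) \<noteq> 0"
    using hausdorff_delta_UN_null[of UNIV gg \<delta> P] \<delta> by (metis countableI_type less_numeral_extra(3))
  define M where "M = real (max 1 (fst i))"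
  have M: "1 \<le> M" by (simp add: M_def)
  have PL: "P i \<subseteq> L" by (auto simp: P_def)
  have diam: "dist x y \<le> (1/2)^m" if "x \<in> P i" "y \<in> P i" for x y
    using dist_le_if_dyadic_eq[of "Suc m" x y] that by (simp add: P_def)
  have seg_sub: "seg e \<subseteq> (\<lambda>t. a e + t *\<^sub>R e) ` {0..M}" if "e \<in> P i" for e
  proof
    fix x assume "x \<in> seg e"
    then obtain u where u: "0 \<le> u" "u \<le> 1" "x = (1 - u) *\<^sub>R a e + u *\<^sub>R (a e + t e *\<^sub>R e)"
      by (auto simp: seg_def in_segment)
    have te: "0 < t e" "t e \<le> M" using that t PL by (auto simp: P_def M_def)
    then have "u * t e \<le> 1 * M" using u M by (intro mult_mono) auto
    moreover have "x = a e + (u * t e) *\<^sub>R e" using u(3) by (simp add: algebra_simps)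
    ultimately show "x \<in> (\<lambda>t. a e + t *\<^sub>R e) ` {0..M}" using u te by (intro image_eqI) auto
  qed
  obtain k where k: "m \<le> k" "(1/2)^k < \<delta>'"
  proof -
    obtain l where l: "(1/2)^l < \<delta>'" using real_arch_pow_inv[OF \<delta>'(1), of "1/2"] by auto
    have "(1/2::real)^max m l \<le> (1/2)^l" by (intro power_decreasing) auto
    then show ?thesis using that[of "max m l"] l by linarith
  qed
  \<comment> \<open>the summand \<open>2\<^sup>-\<^sup>n\<close> makes the weights positive\<close>
  define b where "b n = sqrt ((hh ((1/2)^n))^2 * Cfun gg ((1/2)^n) / h ((1/2)^n)) + (1/2)^n" for n :: nat
  have hpos: "0 < h ((1/2)^n)" for n :: nat using assms(5) by blast
  have quot: "0 \<le> (hh ((1/2)^n))^2 * Cfun gg ((1/2)^n) / h ((1/2)^n)" for n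
    using Cfun_nonneg[OF assms(1)] hpos[of n] by simp
  have b: "0 < b n" for n using quot[of n] by (auto simp: b_def intro: add_nonneg_pos)
  have bsum: "summable b" unfolding b_def using assms(6) by (intro summable_add summable_geometric) auto
  have b2: "(hh ((1/2)^n))\<^sup>2 * Cfun gg ((1/2)^n) \<le> (b n)\<^sup>2 * h ((1/2)^n)" for n
  proof -
    have "(hh ((1/2)^n))\<^sup>2 * Cfun gg ((1/2)^n) / h ((1/2)^n)
        = (sqrt ((hh ((1/2)^n))^2 * Cfun gg ((1/2)^n) / h ((1/2)^n)))\<^sup>2"
      using quot by simp
    also have "\<dots> \<le> (b n)\<^sup>2" unfolding b_def using quot by (intro power_mono) auto
    finally show ?thesis using hpos[of n] by (simp add: divide_le_eq)
  qed
  define c where "c = 1980000 * M * D\<^sup>2 * (suminf b)\<^sup>2"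
  have "0 < suminf b" using b bsum by (intro suminf_pos) auto
  then have c: "0 < c" using M D by (simp add: c_def)
  \<comment> \<open>Both \<open>c\<close> and \<open>k\<close> were fixed before any cover of
    \<open>E\<close>, so the estimate passes to the infimum over all covers by sets of diameter
    below \<open>(1/2)^k\<close>.\<close>
  have "hausdorff_delta gg \<delta> (P i) / ennreal c \<le> hausdorff_delta h ((1/2)^k) E"
    unfolding hausdorff_delta_def[of h]
  proof (rule INF_greatest, clarify)
    fix B :: "nat \<Rightarrow> (real^2) set"
    assume B: "E \<subseteq> (\<Union>i. B i)" "\<forall>i. bounded (B i) \<and> diameter (B i) < (1/2)^k"
    have "hausdorff_delta gg \<delta> (P i) \<le> ennreal c * (\<Sum>i. ennreal (h (diameter (B i))))"
      unfolding c_def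
      by (rule directions_content_le_cover[OF assms(1) hh assms(4) D hpos subset_trans[OF PL L(1)] diam m k seg_sub M _ b bsum b2 B(1)])
         (use big PL B in blast)+
    then show "hausdorff_delta gg \<delta> (P i) / ennreal c \<le> (\<Sum>i. ennreal (h (diameter (B i))))"
      using c by (intro divide_le_posI_ennreal) (auto simp: mult.commute)
  qed
  moreover have "0 < hausdorff_delta gg \<delta> (P i) / ennreal c"
    using i by (simp add: ennreal_zero_less_divide less_top[symmetric] zero_less_iff_neq_zero)
  moreover have "hausdorff_delta h ((1/2)^k) E \<le> hausdorff_h h E"
    unfolding hausdorff_h_def by (intro SUP_upper) auto
  ultimately show ?thesis by (meson less_le_trans)
qed

end
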